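(* Let $r\geq 3$. Then $\kappa_2(O^{+}(2r,2))=3(2^{2r-3}-2^{r-2})-3=2k-\lambda-3$, where $k=2^{2r-2}-2^{r-1}$ and $\lambda=2^{2r-3}-2^{r-2}$. Moreover, the only disconnecting sets $S$ of this size such that every component of $O^{+}(2r,2)\setminus S$ has at least two vertices are the neighborhoods of hyperbolic lines, that is, the sets of the form $N(\{x,y,x+y\})$ where $x$ and $y$ are adjacent vertices.
   Context: Let $M$ be the $2r\times 2r$ block diagonal matrix over $\mathbb{F}_2$ all of whose diagonal blocks are $\begin{bmatrix}0&-1\\1&0\end{bmatrix}$. The hyperbolic quadric graph $O^{+}(2r,2)$ has vertex set $V^{+}=\{(x_1,\dots,x_{2r})^t\in\mathbb{F}_2^{2r}: x_1x_2+x_3x_4+\dots+x_{2r-1}x_{2r}=1\}$, with $x$ adjacent to $y$ if and only if $x^tMy=1$. It is strongly regular with parameters $(v,k,\lambda,\mu)=(2^{2r-1}-2^{r-1},2^{2r-2}-2^{r-1},2^{2r-3}-2^{r-2},2^{2r-3}-2^{r-1})$: $v$ vertices, $k$-regular, adjacent vertices have $\lambda$ common neighbors and distinct non-adjacent vertices have $\mu$ common neighbors. For a graph $G$ and $X\subset V(G)$, $N(X)=\{y\notin X: y\sim x\text{ for some }x\in X\}$. A disconnecting set of a connected graph $G$ is a set $S$ of vertices such that $G\setminus S$ is disconnected. $\kappa_2(G)$ denotes the minimum size of a disconnecting set $S$ of $G$ such that every component of $G\setminus S$ has at least two vertices. *)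

theory Defs
  imports
    "Jordan_Normal_Form.Matrix"
    "Graph_Theory.Digraph_Component"
    "HOL-Library.Z2"
begin

text \<open>
  As in the session Graph\_Theory, a graph is a finite symmetric digraph without loops or
  parallel arcs. For symmetric digraphs \<open>sccs\<close> is the set of connected components.
\<close>

definition neighborhood :: "('a, 'b) pre_digraph \<Rightarrow> 'a set \<Rightarrow> 'a set" where
  "neighborhood G X = {y. y \<notin> X \<and> (\<exists>x\<in>X. y \<rightarrow>\<^bsub>G\<^esub> x)}"

definition delete_verts :: "('a, 'b) pre_digraph \<Rightarrow> 'a set \<Rightarrow> ('a, 'b) pre_digraph" where
  "delete_verts G S = G \<restriction> (verts G - S)"

text \<open>
  The library counts the null graph as not connected. It is not disconnected either (it has no
  two components), hence the requirement \<open>S \<noteq> verts G\<close>.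
\<close>
definition disconnecting_set :: "('a, 'b) pre_digraph \<Rightarrow> 'a set \<Rightarrow> bool" where
  "disconnecting_set G S \<longleftrightarrow>
     S \<subseteq> verts G \<and> S \<noteq> verts G \<and> \<not> Digraph_Component.connected (delete_verts G S)"

definition disconnecting_set2 :: "('a, 'b) pre_digraph \<Rightarrow> 'a set \<Rightarrow> bool" where
  "disconnecting_set2 G S \<longleftrightarrow>
     disconnecting_set G S \<and> (\<forall>C\<in>pre_digraph.sccs (delete_verts G S). 2 \<le> card (verts C))"

text \<open>
  The infimum in \<^typ>\<open>nat\<close> of a nonempty set is its minimum. Since \<open>Inf {} = 0\<close>, a positive
  value of \<open>kappa2\<close> is always attained.
\<close>
definition kappa2 :: "('a, 'b) pre_digraph \<Rightarrow> nat" where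
  "kappa2 G = Inf {card S | S. disconnecting_set2 G S}"

definition hyp_form_mat :: "nat \<Rightarrow> bit mat" where
  "hyp_form_mat r = diag_block_mat (replicate r (mat_of_rows_list 2 [[0, -1], [1, 0]]))"

text \<open>Vector coordinates are indexed from 0, so \<open>x\<^sub>1, \<dots>, x\<^sub>2\<^sub>r\<close> are \<open>x $ 0, \<dots>, x $ (2 * r - 1)\<close>.\<close>
definition hyp_quadric_verts :: "nat \<Rightarrow> bit vec set" where
  "hyp_quadric_verts r =
     {x \<in> carrier_vec (2 * r). (\<Sum>i<r. x $ (2 * i) * x $ (2 * i + 1)) = 1}"

definition hyp_quadric_graph :: "nat \<Rightarrow> bit vec pair_pre_digraph" where
  "hyp_quadric_graph r =
     \<lparr> pverts = hyp_quadric_verts r,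
       parcs = {(x, y). x \<in> hyp_quadric_verts r \<and> y \<in> hyp_quadric_verts r \<and>
                        x \<bullet> (hyp_form_mat r *\<^sub>v y) = 1} \<rparr>"

end

theory Submission
  imports Defs
begin

text \<open>
  If the vertices outside \<open>S\<close> split into parts \<open>A\<close> and \<open>B\<close> without edges between them, then \<open>A\<close>
  and \<open>B\<close> are orthogonal for the polar form, so they lie in orthogonal subspaces \<open>U\<close> and
  \<open>W = U\<^sup>\<bottom>\<close>. For a subspace \<open>U\<close> the number of vertices in \<open>U\<close> is \<open>(|U| - s(U)) / 2\<close>, where
  \<open>s(U)\<close> is the sum of \<open>(-1)\<close> to the power \<open>Q(u)\<close> over \<open>u \<in> U\<close>. Fourier inversion gives
  \<open>|U| |W| = N\<^sup>2\<close> and \<open>N s(U) = |U| s(W)\<close> with \<open>N = 2\<^sup>r\<close>. As \<open>A\<close> and \<open>B\<close> contain edges, \<open>U\<close> and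
  \<open>W\<close> contain hyperbolic lines, which forces \<open>|s(U)| \<le> |U| / 2\<close>. For \<open>4 \<le> |U| \<le> N\<close> the resulting
  bound on \<open>|A| + |B|\<close> is largest exactly when \<open>|U| = 4\<close>, that is, when \<open>U\<close> is a hyperbolic line.
\<close>

section \<open>Disconnecting sets without isolated vertices\<close>

lemma (in sym_digraph) connected_iff_strongly_connected:
  "Digraph_Component.connected G \<longleftrightarrow> strongly_connected G"
  using reachable_mk_symmetric_eq[OF sym_arcs]
  by (auto simp: Digraph_Component.connected_def strongly_connected_def)

text \<open>The vertices reachable from a fixed \<open>u\<close> form one part, and conversely a
  path cannot leave a part. The null graph must be excluded: it counts as not connected, but has no
  two nonempty parts.\<close>

lemma (in sym_digraph) not_connected_iff_partition:
  assumes "verts G \<noteq> {}"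
  shows "\<not> Digraph_Component.connected G \<longleftrightarrow>
    (\<exists>A B. A \<union> B = verts G \<and> A \<inter> B = {} \<and> A \<noteq> {} \<and> B \<noteq> {} \<and> (\<forall>a\<in>A. \<forall>b\<in>B. \<not> a \<rightarrow>\<^bsub>G\<^esub> b))"
    (is "_ \<longleftrightarrow> ?R")
proof
  assume "\<not> Digraph_Component.connected G"
  then obtain u v where uv: "u \<in> verts G" "v \<in> verts G" "\<not> u \<rightarrow>\<^sup>*\<^bsub>G\<^esub> v"
    using assms by (auto simp: connected_iff_strongly_connected strongly_connected_def)
  let ?A = "{w \<in> verts G. u \<rightarrow>\<^sup>*\<^bsub>G\<^esub> w}"
  show ?R
  proof (intro exI conjI)
    show "?A \<noteq> {}" using uv(1) by auto
    show "verts G - ?A \<noteq> {}" using uv by auto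
    show "\<forall>a\<in>?A. \<forall>b\<in>verts G - ?A. \<not> a \<rightarrow>\<^bsub>G\<^esub> b"
      by (auto dest: reachable_adj_trans)
  qed auto
next
  assume ?R
  then obtain A B where AB: "A \<union> B = verts G" "A \<inter> B = {}" "A \<noteq> {}" "B \<noteq> {}"
    "\<And>a b. a \<in> A \<Longrightarrow> b \<in> B \<Longrightarrow> \<not> a \<rightarrow>\<^bsub>G\<^esub> b" by blast
  obtain u v where uv: "u \<in> A" "v \<in> B" using AB by blast
  have "w \<in> A" if "u \<rightarrow>\<^sup>*\<^bsub>G\<^esub> w" for w
    using that
  proof (induction rule: reachable_induct)
    case (step x y)
    then show ?case using AB(1,5) adj_in_verts(2) by blast
  qed (use uv in auto)
  hence "\<not> u \<rightarrow>\<^sup>*\<^bsub>G\<^esub> v" using uv AB(2) by blast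
  thus "\<not> Digraph_Component.connected G"
    using uv AB(1) by (auto simp: connected_iff_strongly_connected strongly_connected_def)
qed

text \<open>A component with a single vertex is an isolated vertex, and without loops a neighbor is
  always a second vertex of the component. This replaces the condition on components by a local
  one.\<close>

lemma (in graph) sccs_ge_2_iff:
  "(\<forall>C\<in>sccs. 2 \<le> card (verts C)) \<longleftrightarrow> (\<forall>v\<in>verts G. \<exists>w. v \<rightarrow>\<^bsub>G\<^esub> w)"
proof
  assume big: "\<forall>C\<in>sccs. 2 \<le> card (verts C)"
  show "\<forall>v\<in>verts G. \<exists>w. v \<rightarrow>\<^bsub>G\<^esub> w"
  proof
    fix v assume v: "v \<in> verts G"
    have "2 \<le> card {w. v \<rightarrow>\<^sup>*\<^bsub>G\<^esub> w}"
      using big induce_reachable_is_in_sccs[OF v] by force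
    hence "\<not> {w. v \<rightarrow>\<^sup>*\<^bsub>G\<^esub> w} \<subseteq> {v}"
      using card_mono[of "{v}" "{w. v \<rightarrow>\<^sup>*\<^bsub>G\<^esub> w}"] by auto
    then obtain w where "v \<rightarrow>\<^sup>*\<^bsub>G\<^esub> w" "w \<noteq> v" by blast
    thus "\<exists>w. v \<rightarrow>\<^bsub>G\<^esub> w" by (metis converse_reachable_cases)
  qed
next
  assume nb: "\<forall>v\<in>verts G. \<exists>w. v \<rightarrow>\<^bsub>G\<^esub> w"
  show "\<forall>C\<in>sccs. 2 \<le> card (verts C)"
  proof
    fix C assume "C \<in> sccs"
    hence C: "verts C \<in> sccs_verts" by (simp add: sccs_verts_conv)
    hence sub: "verts C \<subseteq> verts G" by (rule sccs_verts_subsets)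
    obtain v where v: "v \<in> verts C" using C by (auto simp: sccs_verts_def)
    obtain w where w: "v \<rightarrow>\<^bsub>G\<^esub> w" using nb v sub by blast
    have wv: "w \<rightarrow>\<^bsub>G\<^esub> v" using w by (rule graph_symmetric)
    hence "w \<in> verts C"
      using C v reachable_adjI[OF w] reachable_adjI[OF wv]
      unfolding in_sccs_verts_conv_reachable by blast
    moreover have "v \<noteq> w" using w no_loops by (auto simp: arcs_ends_conv)
    ultimately have "card {v, w} \<le> card (verts C)"
      using v sub by (intro card_mono finite_subset[OF sub]) auto
    thus "2 \<le> card (verts C)" using \<open>v \<noteq> w\<close> by simp
  qed
qed

lemma dominates_delete_verts:
  "u \<rightarrow>\<^bsub>delete_verts G S\<^esub> v \<longleftrightarrow> u \<rightarrow>\<^bsub>G\<^esub> v \<and> u \<in> verts G - S \<and> v \<in> verts G - S"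
  by (auto simp: delete_verts_def arcs_ends_conv)

lemma (in graph) graph_delete_verts: "graph (delete_verts G S)"
proof -
  let ?H = "delete_verts G S"
  have ind: "induced_subgraph ?H G" unfolding delete_verts_def by (rule induced_induce) auto
  interpret H: sym_digraph ?H using ind by (rule induced_graph_imp_graph)
  have "digraph ?H" using ind by (rule digraphI_induced)
  thus ?thesis using H.sym_arcs by (rule digraph.graphI)
qed

text \<open>From here on, components and reachability are replaced by the adjacency relation of the
  original graph. The nonempty parts already encode \<open>S \<noteq> verts G\<close>.\<close>

lemma (in graph) disconnecting_set2_iff:
  "disconnecting_set2 G S \<longleftrightarrow> S \<subseteq> verts G \<and>
    (\<exists>A B. A \<union> B = verts G - S \<and> A \<inter> B = {} \<and> A \<noteq> {} \<and> B \<noteq> {} \<and> (\<forall>a\<in>A. \<forall>b\<in>B. \<not> a \<rightarrow>\<^bsub>G\<^esub> b)) \<and>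
    (\<forall>v\<in>verts G - S. \<exists>w\<in>verts G - S. v \<rightarrow>\<^bsub>G\<^esub> w)"
proof (cases "S \<subseteq> verts G \<and> S \<noteq> verts G")
  case True
  interpret H: graph "delete_verts G S" by (rule graph_delete_verts)
  have vH: "verts (delete_verts G S) = verts G - S" by (simp add: delete_verts_def)
  have cross: "A \<union> B = verts G - S \<Longrightarrow>
      (\<forall>a\<in>A. \<forall>b\<in>B. \<not> a \<rightarrow>\<^bsub>delete_verts G S\<^esub> b) \<longleftrightarrow> (\<forall>a\<in>A. \<forall>b\<in>B. \<not> a \<rightarrow>\<^bsub>G\<^esub> b)" for A B
    unfolding dominates_delete_verts by blast
  have "verts (delete_verts G S) \<noteq> {}" using True vH by auto
  note part = H.not_connected_iff_partition[OF this, unfolded vH]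
  have "\<not> Digraph_Component.connected (delete_verts G S) \<longleftrightarrow>
     (\<exists>A B. A \<union> B = verts G - S \<and> A \<inter> B = {} \<and> A \<noteq> {} \<and> B \<noteq> {} \<and> (\<forall>a\<in>A. \<forall>b\<in>B. \<not> a \<rightarrow>\<^bsub>G\<^esub> b))"
    unfolding part using cross by (intro ex_cong1 conj_cong refl)
  moreover have "(\<forall>C\<in>pre_digraph.sccs (delete_verts G S). 2 \<le> card (verts C)) \<longleftrightarrow>
     (\<forall>v\<in>verts G - S. \<exists>w\<in>verts G - S. v \<rightarrow>\<^bsub>G\<^esub> w)"
    unfolding H.sccs_ge_2_iff vH by (auto simp: dominates_delete_verts)
  ultimately show ?thesis
    using True by (simp add: disconnecting_set2_def disconnecting_set_def)
next
  case False
  thus ?thesis by (auto simp: disconnecting_set2_def disconnecting_set_def)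
qed

section \<open>The quadratic form and its polar form\<close>

text \<open>These rules would turn sums and products of bits into boolean operations; without them
  the ring laws stay applicable.\<close>

declare add_bit_eq_xor [simp del] mult_bit_eq_and [simp del]

lemma bit_add_self [simp]: "(a::bit) + a = 0"
  by (cases a) simp_all

lemma UNIV_bit: "(UNIV :: bit set) = {0, 1}"
proof -
  have "a \<in> {0, 1}" for a :: bit by (cases a) simp_all
  thus ?thesis by blast
qed

lemma card_carrier_bit_vec: "card (carrier_vec n :: bit vec set) = 2 ^ n"
proof -
  have "bij_betw list_of_vec (carrier_vec n :: bit vec set) {xs. set xs \<subseteq> UNIV \<and> length xs = n}"
  proof (rule bij_betw_byWitness[where f' = vec_of_list])
    show "vec_of_list ` {xs :: bit list. set xs \<subseteq> UNIV \<and> length xs = n} \<subseteq> carrier_vec n"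
      by (intro image_subsetI carrier_vecI) simp
  qed (simp_all add: vec_list list_vec image_subset_iff)
  hence "card (carrier_vec n :: bit vec set) = card {xs :: bit list. set xs \<subseteq> UNIV \<and> length xs = n}"
    by (rule bij_betw_same_card)
  also have "\<dots> = card (UNIV :: bit set) ^ n"
    by (rule card_lists_length_eq) (simp add: UNIV_bit)
  also have "card (UNIV :: bit set) = 2"
    by (simp add: UNIV_bit)
  finally show ?thesis .
qed

lemma finite_carrier_bit_vec [simp]: "finite (carrier_vec n :: bit vec set)"
  by (rule card_ge_0_finite) (simp add: card_carrier_bit_vec)

definition quad_form :: "nat \<Rightarrow> bit vec \<Rightarrow> bit" where
  "quad_form r x = (\<Sum>i<r. x $ (2 * i) * x $ (2 * i + 1))"

text \<open>The polarization of \<open>quad_form\<close>, see \<open>quad_form_add\<close>. The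
  coordinate form separates the algebra from the block matrix, with which it is identified in
  \<open>scalar_prod_hyp_form_mat\<close>.\<close>

definition polar_form :: "nat \<Rightarrow> bit vec \<Rightarrow> bit vec \<Rightarrow> bit" where
  "polar_form r x y = (\<Sum>i<r. x $ (2 * i) * y $ (2 * i + 1) + x $ (2 * i + 1) * y $ (2 * i))"

lemma quad_form_add:
  assumes "x \<in> carrier_vec (2 * r)" "y \<in> carrier_vec (2 * r)"
  shows "quad_form r (x + y) = quad_form r x + quad_form r y + polar_form r x y"
  unfolding quad_form_def polar_form_def sum.distrib[symmetric]
  by (rule sum.cong) (use assms in \<open>auto simp: algebra_simps\<close>)

lemma quad_form_zero [simp]: "quad_form r (0\<^sub>v (2 * r)) = 0"
  by (simp add: quad_form_def)

lemma polar_form_commute: "polar_form r x y = polar_form r y x"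
  by (simp add: polar_form_def algebra_simps)

lemma polar_form_self [simp]: "polar_form r x x = 0"
  by (simp add: polar_form_def mult.commute)

lemma polar_form_add_left:
  assumes "x \<in> carrier_vec (2 * r)" "y \<in> carrier_vec (2 * r)"
  shows "polar_form r (x + y) z = polar_form r x z + polar_form r y z"
  unfolding polar_form_def sum.distrib[symmetric]
  by (rule sum.cong) (use assms in \<open>auto simp: algebra_simps\<close>)

lemma polar_form_add_right:
  assumes "x \<in> carrier_vec (2 * r)" "y \<in> carrier_vec (2 * r)"
  shows "polar_form r z (x + y) = polar_form r z x + polar_form r z y"
  using polar_form_add_left[OF assms] by (simp add: polar_form_commute)

lemma polar_form_zero_left [simp]: "polar_form r (0\<^sub>v (2 * r)) x = 0"
  by (simp add: polar_form_def)

lemma polar_form_zero_right [simp]: "polar_form r x (0\<^sub>v (2 * r)) = 0"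
  by (simp add: polar_form_def)

lemma polar_form_unit_even:
  assumes "i < r"
  shows "polar_form r x (unit_vec (2 * r) (2 * i)) = x $ (2 * i + 1)"
proof -
  have "polar_form r x (unit_vec (2 * r) (2 * i)) = (\<Sum>j<r. if j = i then x $ (2 * i + 1) else 0)"
    unfolding polar_form_def by (rule sum.cong) (use assms in \<open>auto simp: Suc_double_not_eq_double\<close>)
  thus ?thesis using assms by simp
qed

lemma polar_form_unit_odd:
  assumes "i < r"
  shows "polar_form r x (unit_vec (2 * r) (2 * i + 1)) = x $ (2 * i)"
proof -
  have "polar_form r x (unit_vec (2 * r) (2 * i + 1)) = (\<Sum>j<r. if j = i then x $ (2 * i) else 0)"
    unfolding polar_form_def by (rule sum.cong) (use assms in \<open>auto simp: double_not_eq_Suc_double\<close>)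
  thus ?thesis using assms by simp
qed

text \<open>Pairing with unit vectors recovers every coordinate of \<open>x\<close>, each through
  the unit vector of its partner in the same block.\<close>

lemma polar_form_nondegenerate:
  assumes "x \<in> carrier_vec (2 * r)" "\<And>y. y \<in> carrier_vec (2 * r) \<Longrightarrow> polar_form r x y = 0"
  shows "x = 0\<^sub>v (2 * r)"
proof (rule eq_vecI)
  fix i assume "i < dim_vec (0\<^sub>v (2 * r) :: bit vec)"
  hence i: "i div 2 < r" by auto
  show "x $ i = 0\<^sub>v (2 * r) $ i"
  proof (cases "even i")
    case True
    thus ?thesis using polar_form_unit_odd[OF i, of x] assms(2) i by simp
  next
    case False
    thus ?thesis using polar_form_unit_even[OF i, of x] assms(2) i by simp
  qed
qed (use assms(1) in simp)

section \<open>The block matrix and adjacency\<close>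

lemma hyp_form_mat_carrier: "hyp_form_mat r \<in> carrier_mat (2 * r) (2 * r)"
  unfolding hyp_form_mat_def
  by (induction r) (auto simp: Let_def mat_of_rows_list_def numeral_2_eq_2)

text \<open>Over F_2 the entry -1 equals 1, so every block just exchanges its two coordinates. The
  induction splits off the first block, which shifts the remaining indices by 2.\<close>

lemma hyp_form_mat_index:
  "i < 2 * r \<Longrightarrow> j < 2 * r \<Longrightarrow>
    hyp_form_mat r $$ (i, j) = (if i div 2 = j div 2 \<and> i \<noteq> j then 1 else 0)"
proof (induction r arbitrary: i j)
  case 0
  then show ?case by simp
next
  case (Suc r)
  let ?J = "mat_of_rows_list 2 [[0, -1], [1, 0]] :: bit mat"
  have J: "?J \<in> carrier_mat 2 2" by (auto simp: mat_of_rows_list_def numeral_2_eq_2)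
  have M: "dim_row (hyp_form_mat r) = 2 * r" "dim_col (hyp_form_mat r) = 2 * r"
    using hyp_form_mat_carrier[of r] by auto
  have eq: "hyp_form_mat (Suc r) = four_block_mat ?J (0\<^sub>m 2 (2 * r)) (0\<^sub>m (2 * r) 2) (hyp_form_mat r)"
    using carrier_matD[OF J] M
    unfolding hyp_form_mat_def replicate_Suc diag_block_mat.simps Let_def by (simp only:)
  have div2: "k div 2 = Suc ((k - 2) div 2)" if "\<not> k < 2" for k :: nat
    using that by presburger
  have lt2: "k < 2 \<longleftrightarrow> k = 0 \<or> k = Suc 0" for k :: nat by auto
  show ?case
  proof (cases "i < 2")
    case True
    then show ?thesis
    proof (cases "j < 2")
      case True
      then show ?thesis using \<open>i < 2\<close> Suc.prems J M
        by (auto simp: eq lt2 mat_of_rows_list_def)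
    next
      case False
      then show ?thesis using \<open>i < 2\<close> Suc.prems J M div2[of j] by (auto simp: eq)
    qed
  next
    case i: False
    show ?thesis
    proof (cases "j < 2")
      case True
      then show ?thesis using i Suc.prems J M div2[of i] by (auto simp: eq)
    next
      case False
      have "hyp_form_mat (Suc r) $$ (i, j) = hyp_form_mat r $$ (i - 2, j - 2)"
        using i False Suc.prems J M by (simp add: eq)
      also have "\<dots> = (if (i - 2) div 2 = (j - 2) div 2 \<and> i - 2 \<noteq> j - 2 then 1 else 0)"
        using i False Suc.prems by (intro Suc.IH) auto
      also have "\<dots> = (if i div 2 = j div 2 \<and> i \<noteq> j then 1 else 0)"
        using div2[OF i] div2[OF False] i False by auto
      finally show ?thesis .
    qed
  qed
qed

lemma sum_lessThan_double:
  fixes f :: "nat \<Rightarrow> 'a :: comm_monoid_add"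
  shows "(\<Sum>i<2 * r. f i) = (\<Sum>i<r. f (2 * i) + f (2 * i + 1))"
  by (induction r) (simp_all add: add.assoc)

lemma hyp_form_mat_mult_index:
  assumes "y \<in> carrier_vec (2 * r)" "i < r"
  shows "(hyp_form_mat r *\<^sub>v y) $ (2 * i) = y $ (2 * i + 1)"
    and "(hyp_form_mat r *\<^sub>v y) $ (2 * i + 1) = y $ (2 * i)"
proof -
  note M = hyp_form_mat_carrier[of r]
  have row: "(hyp_form_mat r *\<^sub>v y) $ k =
      (\<Sum>j<r. hyp_form_mat r $$ (k, 2 * j) * y $ (2 * j) +
             hyp_form_mat r $$ (k, 2 * j + 1) * y $ (2 * j + 1))" if "k < 2 * r" for k
    using M assms(1) that
    by (simp add: scalar_prod_def lessThan_atLeast0[symmetric] sum_lessThan_double)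
  have i0: "2 * i < 2 * r" and i1: "2 * i + 1 < 2 * r" using assms(2) by auto
  have "(hyp_form_mat r *\<^sub>v y) $ (2 * i) = (\<Sum>j<r. if j = i then y $ (2 * i + 1) else 0)"
    unfolding row[OF i0]
    by (rule sum.cong) (use assms(2) in \<open>auto simp: hyp_form_mat_index\<close>)
  thus "(hyp_form_mat r *\<^sub>v y) $ (2 * i) = y $ (2 * i + 1)" using assms(2) by simp
  have "(hyp_form_mat r *\<^sub>v y) $ (2 * i + 1) = (\<Sum>j<r. if j = i then y $ (2 * i) else 0)"
    unfolding row[OF i1]
    by (rule sum.cong) (use assms(2) in \<open>auto simp: hyp_form_mat_index\<close>)
  thus "(hyp_form_mat r *\<^sub>v y) $ (2 * i + 1) = y $ (2 * i)" using assms(2) by simp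
qed

lemma scalar_prod_hyp_form_mat:
  assumes "y \<in> carrier_vec (2 * r)"
  shows "x \<bullet> (hyp_form_mat r *\<^sub>v y) = polar_form r x y"
proof -
  have "x \<bullet> (hyp_form_mat r *\<^sub>v y) = (\<Sum>i<2 * r. x $ i * (hyp_form_mat r *\<^sub>v y) $ i)"
    using hyp_form_mat_carrier[of r]
    by (simp add: scalar_prod_def lessThan_atLeast0)
  also have "\<dots> = polar_form r x y"
    unfolding sum_lessThan_double polar_form_def
    by (rule sum.cong) (use hyp_form_mat_mult_index[OF assms] in auto)
  finally show ?thesis .
qed

lemma hyp_quadric_verts_eq:
  "hyp_quadric_verts r = {x \<in> carrier_vec (2 * r). quad_form r x = 1}"
  by (simp add: hyp_quadric_verts_def quad_form_def)

lemma verts_hyp_quadric_graph: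
  "verts (hyp_quadric_graph r) = hyp_quadric_verts r"
  by (simp add: hyp_quadric_graph_def)

lemma hyp_quadric_dominates:
  "x \<rightarrow>\<^bsub>hyp_quadric_graph r\<^esub> y \<longleftrightarrow>
    x \<in> hyp_quadric_verts r \<and> y \<in> hyp_quadric_verts r \<and> polar_form r x y = 1"
  by (auto simp: hyp_quadric_graph_def scalar_prod_hyp_form_mat hyp_quadric_verts_eq)

lemma finite_hyp_quadric_verts: "finite (hyp_quadric_verts r)"
  by (rule finite_subset[OF _ finite_carrier_bit_vec[of "2 * r"]]) (auto simp: hyp_quadric_verts_def)

lemma graph_hyp_quadric_graph: "graph (hyp_quadric_graph r)"
proof -
  let ?G = "hyp_quadric_graph r"
  have "parcs ?G \<subseteq> hyp_quadric_verts r \<times> hyp_quadric_verts r"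
    by (auto simp: hyp_quadric_graph_def)
  hence fin: "finite (parcs ?G)"
    by (rule finite_subset) (intro finite_cartesian_product finite_hyp_quadric_verts)
  have arc: "(x, y) \<in> parcs ?G \<longleftrightarrow>
      x \<in> hyp_quadric_verts r \<and> y \<in> hyp_quadric_verts r \<and> polar_form r x y = 1" for x y
    using hyp_quadric_dominates[of x y r] by simp
  interpret pair_graph ?G
    by unfold_locales
      (auto simp: arc fin finite_hyp_quadric_verts polar_form_commute symmetric_def sym_def
        verts_hyp_quadric_graph[simplified])
  show ?thesis by unfold_locales (rule sym_arcs)
qed

section \<open>Character sums over subspaces\<close>

lemma bit_vec_add_cancel:
  assumes "x \<in> carrier_vec n" "a \<in> carrier_vec n"
  shows "x + a + a = (x :: bit vec)"
  using assms by (intro eq_vecI) (auto simp: add.assoc)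

text \<open>The only scalars are 0 and 1, so these closure properties already describe linear
  subspaces.\<close>

definition f2_subspace :: "nat \<Rightarrow> bit vec set \<Rightarrow> bool" where
  "f2_subspace r U \<longleftrightarrow> U \<subseteq> carrier_vec (2 * r) \<and> 0\<^sub>v (2 * r) \<in> U \<and> (\<forall>x\<in>U. \<forall>y\<in>U. x + y \<in> U)"

text \<open>Allowing an arbitrary set \<open>X\<close> lets a set of vertices produce a subspace
  directly, without passing to its span.\<close>

definition orth :: "nat \<Rightarrow> bit vec set \<Rightarrow> bit vec set" where
  "orth r X = {w \<in> carrier_vec (2 * r). \<forall>x\<in>X. polar_form r w x = 0}"

lemma f2_subspace_finite: "f2_subspace r U \<Longrightarrow> finite U"
  unfolding f2_subspace_def using finite_subset[OF _ finite_carrier_bit_vec] by blast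

lemma f2_subspace_carrier: "f2_subspace r (carrier_vec (2 * r))"
  by (auto simp: f2_subspace_def)

lemma f2_subspace_orth: "f2_subspace r (orth r X)"
  by (auto simp: f2_subspace_def orth_def polar_form_add_left)

text \<open>The nontrivial additive character of F_2, with integer values so that its sums count
  elements.\<close>

definition bit_sign :: "bit \<Rightarrow> int" where
  "bit_sign a = (if a = 0 then 1 else -1)"

lemma bit_sign_simps [simp]: "bit_sign 0 = 1" "bit_sign 1 = -1"
  by (simp_all add: bit_sign_def)

lemma bit_sign_add: "bit_sign (a + b) = bit_sign a * bit_sign b"
  by (cases a; cases b) simp_all

lemma bit_sign_square [simp]: "bit_sign a * bit_sign a = 1" "bit_sign a * (bit_sign a * c) = c"
  by (cases a; simp)+

lemma sum_f2_subspace_translate: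
  assumes "f2_subspace r U" "a \<in> U"
  shows "(\<Sum>x\<in>U. f (x + a)) = (\<Sum>x\<in>U. f x)"
proof -
  have "x + a + a = x" if "x \<in> U" for x
    using that assms bit_vec_add_cancel unfolding f2_subspace_def by blast
  moreover have "x + a \<in> U" if "x \<in> U" for x
    using that assms unfolding f2_subspace_def by blast
  ultimately show ?thesis
    by (intro sum.reindex_bij_witness[of _ "\<lambda>x. x + a" "\<lambda>x. x + a"]) simp_all
qed

text \<open>Orthogonality of characters: if some \<open>a\<close> in \<open>U\<close> is not
  orthogonal to \<open>x\<close>, then translation by \<open>a\<close> permutes \<open>U\<close> and
  negates the sum, which is therefore 0.\<close>

lemma sum_bit_sign_polar_form:
  assumes "f2_subspace r U" "x \<in> carrier_vec (2 * r)"
  shows "(\<Sum>u\<in>U. bit_sign (polar_form r x u)) = (if x \<in> orth r U then int (card U) else 0)"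
proof (cases "x \<in> orth r U")
  case True
  then show ?thesis by (simp add: orth_def)
next
  case False
  then obtain a where a: "a \<in> U" "polar_form r x a = 1"
    using assms(2) unfolding orth_def by auto
  have "bit_sign (polar_form r x (u + a)) = - bit_sign (polar_form r x u)" if "u \<in> U" for u
  proof -
    have "u \<in> carrier_vec (2 * r)" "a \<in> carrier_vec (2 * r)"
      using that a(1) assms(1) unfolding f2_subspace_def by blast+
    thus ?thesis by (simp add: polar_form_add_right bit_sign_add a(2))
  qed
  hence "(\<Sum>u\<in>U. bit_sign (polar_form r x (u + a))) = - (\<Sum>u\<in>U. bit_sign (polar_form r x u))"
    by (simp add: sum_negf)
  hence "(\<Sum>u\<in>U. bit_sign (polar_form r x u)) = 0"
    using sum_f2_subspace_translate[OF assms(1) a(1), of "\<lambda>u. bit_sign (polar_form r x u)"] by simp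
  then show ?thesis using False by simp
qed

lemma orth_carrier: "orth r (carrier_vec (2 * r)) = {0\<^sub>v (2 * r)}"
  using polar_form_nondegenerate by (auto simp: orth_def)

text \<open>The characters are summed over all pairs \<open>(x, u)\<close> in both orders. Summing
  over \<open>u\<close> first leaves the \<open>x\<close> in \<open>orth r U\<close>; summing over
  \<open>x\<close> first leaves only \<open>u = 0\<close>, by nondegeneracy.\<close>

lemma card_orth:
  assumes "f2_subspace r U"
  shows "card U * card (orth r U) = 2 ^ (2 * r)"
proof -
  let ?V = "carrier_vec (2 * r) :: bit vec set"
  have fin: "finite U" using assms by (rule f2_subspace_finite)
  have U: "U \<subseteq> ?V" "0\<^sub>v (2 * r) \<in> U" using assms by (auto simp: f2_subspace_def)
  have "(\<Sum>x\<in>?V. \<Sum>u\<in>U. bit_sign (polar_form r x u)) = (\<Sum>x\<in>?V. if x \<in> orth r U then int (card U) else 0)"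
    by (rule sum.cong) (simp_all add: sum_bit_sign_polar_form[OF assms])
  also have "\<dots> = int (card U) * int (card (orth r U))"
    by (simp add: sum.If_cases orth_def Int_def conj_commute)
  finally have 1: "(\<Sum>x\<in>?V. \<Sum>u\<in>U. bit_sign (polar_form r x u)) = int (card U * card (orth r U))"
    by simp
  have "(\<Sum>x\<in>?V. \<Sum>u\<in>U. bit_sign (polar_form r x u)) = (\<Sum>u\<in>U. \<Sum>x\<in>?V. bit_sign (polar_form r u x))"
    by (subst sum.swap) (simp add: polar_form_commute)
  also have "\<dots> = (\<Sum>u\<in>U. if u = 0\<^sub>v (2 * r) then int (card ?V) else 0)"
  proof (rule sum.cong)
    fix u assume "u \<in> U"
    hence "u \<in> ?V" using U by blast
    thus "(\<Sum>x\<in>?V. bit_sign (polar_form r u x)) = (if u = 0\<^sub>v (2 * r) then int (card ?V) else 0)"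
      using sum_bit_sign_polar_form[OF f2_subspace_carrier, of u r] by (simp add: orth_carrier)
  qed simp
  also have "\<dots> = int (card ?V)"
    using fin U by simp
  finally have "int (card U * card (orth r U)) = int (card ?V)"
    using 1 by simp
  thus ?thesis unfolding card_carrier_bit_vec by (simp only: of_nat_eq_iff)
qed

text \<open>A quadratic Gauss sum: the number of zeros of \<open>quad_form\<close> on
  \<open>U\<close> minus the number of its ones.\<close>

definition sign_sum :: "nat \<Rightarrow> bit vec set \<Rightarrow> int" where
  "sign_sum r U = (\<Sum>x\<in>U. bit_sign (quad_form r x))"

text \<open>Poisson summation for the sign of Q(x) + B(x,u), where Q and B are the quadratic and the
  polar form. Summing over \<open>u\<close> first leaves \<open>orth r U\<close>. For fixed
  \<open>u\<close>, completing the square gives Q(x) + B(x,u) = Q(x+u) + Q(u), and the translation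
  by \<open>u\<close> disappears from the sum over the whole space.\<close>

lemma sign_sum_carrier_times:
  assumes "f2_subspace r U"
  shows "sign_sum r (carrier_vec (2 * r)) * sign_sum r U = int (card U) * sign_sum r (orth r U)"
proof -
  let ?V = "carrier_vec (2 * r) :: bit vec set"
  let ?f = "\<lambda>u x. bit_sign (quad_form r x) * bit_sign (polar_form r x u)"
  have U: "U \<subseteq> ?V" using assms by (auto simp: f2_subspace_def)
  have "(\<Sum>x\<in>?V. \<Sum>u\<in>U. ?f u x) = (\<Sum>x\<in>?V. if x \<in> orth r U then int (card U) * bit_sign (quad_form r x) else 0)"
    by (rule sum.cong) (simp_all add: sum_bit_sign_polar_form[OF assms] flip: sum_distrib_left)
  also have "\<dots> = int (card U) * sign_sum r (orth r U)"
    unfolding sign_sum_def sum_distrib_left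
    by (rule sum.mono_neutral_cong_right) (auto simp: orth_def)
  finally have 1: "(\<Sum>x\<in>?V. \<Sum>u\<in>U. ?f u x) = int (card U) * sign_sum r (orth r U)" .
  have "(\<Sum>x\<in>?V. ?f u x) = bit_sign (quad_form r u) * sign_sum r ?V" if "u \<in> U" for u
  proof -
    have u: "u \<in> ?V" using that U by blast
    have "(\<Sum>x\<in>?V. ?f u x) = (\<Sum>x\<in>?V. bit_sign (quad_form r u) * bit_sign (quad_form r (x + u)))"
      by (rule sum.cong) (use u in \<open>auto simp: quad_form_add bit_sign_add mult_ac\<close>)
    also have "\<dots> = bit_sign (quad_form r u) * (\<Sum>x\<in>?V. bit_sign (quad_form r (x + u)))"
      by (simp add: sum_distrib_left)
    also have "(\<Sum>x\<in>?V. bit_sign (quad_form r (x + u))) = sign_sum r ?V"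
      unfolding sign_sum_def by (rule sum_f2_subspace_translate[OF f2_subspace_carrier u])
    finally show ?thesis .
  qed
  hence "(\<Sum>u\<in>U. \<Sum>x\<in>?V. ?f u x) = sign_sum r ?V * sign_sum r U"
    by (simp add: sign_sum_def[of r U] sum_distrib_left sum_distrib_right mult.commute[of "sign_sum r ?V"])
  thus ?thesis using 1 by (subst (asm) sum.swap) simp
qed

lemma sign_sum_carrier: "sign_sum r (carrier_vec (2 * r)) = 2 ^ r"
proof -
  \<comment> \<open>A subspace on which the quadratic form vanishes and which is its own orthogonal
    complement. Its size is therefore \<open>2 ^ r\<close>, its signs are all 1, and the Poisson
    formula applied to it yields the sum over the whole space.\<close>
  let ?L = "{x \<in> carrier_vec (2 * r). \<forall>i<r. x $ (2 * i) = (0 :: bit)}"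
  have sub: "f2_subspace r ?L" by (auto simp: f2_subspace_def)
  have orthL: "orth r ?L = ?L"
  proof (intro equalityI subsetI)
    fix x assume x: "x \<in> orth r ?L"
    have "x $ (2 * i) = 0" if i: "i < r" for i
    proof -
      have "unit_vec (2 * r) (2 * i + 1) \<in> ?L" using i by (auto simp: double_not_eq_Suc_double)
      hence "polar_form r x (unit_vec (2 * r) (2 * i + 1)) = 0" using x unfolding orth_def by blast
      thus ?thesis using polar_form_unit_odd[OF i] by simp
    qed
    thus "x \<in> ?L" using x by (simp add: orth_def)
  qed (auto simp: orth_def polar_form_def)
  have "card ?L * card ?L = 2 ^ (2 * r)" using card_orth[OF sub] orthL by simp
  hence "(card ?L)\<^sup>2 = (2 ^ r)\<^sup>2" by (simp add: power2_eq_square mult_2 power_add)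
  hence card: "card ?L = 2 ^ r" by simp
  have "sign_sum r ?L = int (card ?L)"
    by (simp add: sign_sum_def quad_form_def)
  thus ?thesis using sign_sum_carrier_times[OF sub] orthL card by simp
qed

lemma sign_sum_orth:
  assumes "f2_subspace r U"
  shows "2 ^ r * sign_sum r U = int (card U) * sign_sum r (orth r U)"
  using sign_sum_carrier_times[OF assms] by (simp add: sign_sum_carrier)

lemma two_card_quadric_Int:
  assumes "f2_subspace r U"
  shows "2 * int (card (hyp_quadric_verts r \<inter> U)) = int (card U) - sign_sum r U"
proof -
  have fin: "finite U" using assms by (rule f2_subspace_finite)
  have "int (card U) - sign_sum r U = (\<Sum>x\<in>U. 1 - bit_sign (quad_form r x))"
    by (simp add: sign_sum_def sum_subtractf)
  also have "\<dots> = (\<Sum>x\<in>U. if x \<in> hyp_quadric_verts r then 2 else 0)"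
    by (rule sum.cong) (use assms in \<open>auto simp: hyp_quadric_verts_eq f2_subspace_def bit_sign_def\<close>)
  also have "\<dots> = 2 * int (card (hyp_quadric_verts r \<inter> U))"
    using fin by (simp add: sum.If_cases Int_commute)
  finally show ?thesis by simp
qed

section \<open>Hyperbolic lines, completed to planes by the zero vector\<close>

definition hyp_line :: "nat \<Rightarrow> bit vec \<Rightarrow> bit vec \<Rightarrow> bit vec set" where
  "hyp_line r x y = {0\<^sub>v (2 * r), x, y, x + y}"

locale hyperbolic_pair =
  fixes r :: nat and x y :: "bit vec"
  assumes x: "x \<in> hyp_quadric_verts r" and y: "y \<in> hyp_quadric_verts r"
    and xy: "polar_form r x y = 1"
begin

lemma carrier [simp]: "x \<in> carrier_vec (2 * r)" "y \<in> carrier_vec (2 * r)"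
  using x y by (auto simp: hyp_quadric_verts_eq)

lemma quad_form_xy [simp]: "quad_form r x = 1" "quad_form r y = 1"
  using x y by (auto simp: hyp_quadric_verts_eq)

lemma polar_form_xy [simp]:
  "polar_form r x y = 1" "polar_form r y x = 1"
  "polar_form r x (x + y) = 1" "polar_form r (x + y) x = 1"
  "polar_form r y (x + y) = 1" "polar_form r (x + y) y = 1"
  using xy polar_form_commute[of r y x]
  by (simp_all add: polar_form_add_left polar_form_add_right)

lemma quad_form_add_xy [simp]: "quad_form r (x + y) = 1"
  by (simp add: quad_form_add)

lemma add_xy: "x + y \<in> hyp_quadric_verts r"
  by (simp add: hyp_quadric_verts_eq)

lemma distinct_xy: "distinct [0\<^sub>v (2 * r), x, y, x + y]"
proof -
  have "x \<noteq> 0\<^sub>v (2 * r)" "y \<noteq> 0\<^sub>v (2 * r)" "x + y \<noteq> 0\<^sub>v (2 * r)"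
    using quad_form_xy quad_form_add_xy quad_form_zero[of r] by (metis zero_neq_one)+
  moreover have "x \<noteq> y" "x \<noteq> x + y" "y \<noteq> x + y"
    using polar_form_xy polar_form_self[of r] by (metis zero_neq_one)+
  ultimately show ?thesis by simp
qed

lemma hyp_line_subspace: "f2_subspace r (hyp_line r x y)"
proof -
  note dims = carrier[THEN carrier_vecD]
  have "x + x = 0\<^sub>v (2 * r)" "y + y = 0\<^sub>v (2 * r)" "x + y + (x + y) = 0\<^sub>v (2 * r)"
    by (rule eq_vecI; simp add: dims)+
  moreover have "x + (x + y) = y" "x + y + x = y" "y + (x + y) = x" "x + y + y = x" "y + x = x + y"
    by (rule eq_vecI; simp add: dims ac_simps; simp add: dims flip: add.assoc)+
  ultimately show ?thesis
    by (auto simp: f2_subspace_def hyp_line_def)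
qed

lemma card_hyp_line: "card (hyp_line r x y) = 4"
  using distinct_xy by (simp add: hyp_line_def)

lemma sign_sum_hyp_line: "sign_sum r (hyp_line r x y) = -2"
  using distinct_xy by (simp add: sign_sum_def hyp_line_def)

lemma quadric_Int_hyp_line: "hyp_quadric_verts r \<inter> hyp_line r x y = {x, y, x + y}"
  by (auto simp: hyp_line_def hyp_quadric_verts_eq)

lemma orth_hyp_line: "orth r (hyp_line r x y) = orth r {x, y, x + y}"
  by (auto simp: orth_def hyp_line_def)

lemma hyp_line_subset:
  assumes "f2_subspace r U" "x \<in> U" "y \<in> U"
  shows "hyp_line r x y \<subseteq> U"
  using assms by (auto simp: f2_subspace_def hyp_line_def)

text \<open>On every coset of the hyperbolic line the signs sum to \<open>2\<close> or \<open>-2\<close>.\<close>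
lemma sign_sum_bound:
  assumes U: "f2_subspace r U" and xU: "x \<in> U" and yU: "y \<in> U"
  shows "2 * \<bar>sign_sum r U\<bar> \<le> int (card U)"
proof -
  let ?q = "\<lambda>u. bit_sign (quad_form r u)"
  have xyU: "x + y \<in> U" using U xU yU by (auto simp: f2_subspace_def)
  note tr = sum_f2_subspace_translate[OF U, of _ ?q]
  \<comment> \<open>Each translation by an element of the line permutes \<open>U\<close>, so summing
    over all coset representatives with multiplicity gives four times the sum.\<close>
  have "4 * sign_sum r U = (\<Sum>u\<in>U. ?q u + ?q (u + x) + ?q (u + y) + ?q (u + (x + y)))"
    unfolding sum.distrib by (simp add: tr[OF xU] tr[OF yU] tr[OF xyU] sign_sum_def)
  also have "\<bar>\<dots>\<bar> \<le> (\<Sum>u\<in>U. \<bar>?q u + ?q (u + x) + ?q (u + y) + ?q (u + (x + y))\<bar>)"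
    by (rule sum_abs)
  also have "\<dots> \<le> (\<Sum>u\<in>U. 2)"
  proof (rule sum_mono)
    fix u assume "u \<in> U"
    hence u: "u \<in> carrier_vec (2 * r)" using U by (auto simp: f2_subspace_def)
    have "?q (u + x) = - (?q u * bit_sign (polar_form r u x))"
      "?q (u + y) = - (?q u * bit_sign (polar_form r u y))"
      "?q (u + (x + y)) = - (?q u * (bit_sign (polar_form r u x) * bit_sign (polar_form r u y)))"
      using u by (simp_all add: quad_form_add polar_form_add_right bit_sign_add)
    hence "?q u + ?q (u + x) + ?q (u + y) + ?q (u + (x + y)) =
        ?q u * (1 - bit_sign (polar_form r u x) - bit_sign (polar_form r u y)
          - bit_sign (polar_form r u x) * bit_sign (polar_form r u y))"
      by (simp add: right_diff_distrib)
    \<comment> \<open>For signs a and b, the value 1 - a - b - ab is -2 if a = b = 1, and 2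
      otherwise.\<close>
    thus "\<bar>?q u + ?q (u + x) + ?q (u + y) + ?q (u + (x + y))\<bar> \<le> 2"
      by (simp add: bit_sign_def)
  qed
  finally show ?thesis by simp
qed

end

section \<open>Bounds for orthogonal parts\<close>

text \<open>Here \<open>t\<close>, \<open>t'\<close> are the sizes of the two subspaces,
  \<open>s\<close>, \<open>s'\<close> their sign sums and \<open>N = 2 ^ r\<close>. Multiplying the
  deficit by \<open>t\<close> eliminates \<open>t'\<close> and \<open>s'\<close> and leaves (t -
  4)(N^2 - 6t) + 2(t + 2s)(t + N). Both summands are nonnegative, and the first vanishes only for t
  = 4.\<close>

lemma orthogonal_pair_bound_arith:
  fixes t t' s s' N :: int
  assumes "t * t' = N * N" "N * s = t * s'" "2 * \<bar>s\<bar> \<le> t" "4 \<le> t" "t \<le> N" "8 \<le> N"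
  shows "4 * (t + t' - s - s') \<le> N * N + 2 * N + 24"
    and "t \<noteq> 4 \<Longrightarrow> 4 * (t + t' - s - s') < N * N + 2 * N + 24"
proof -
  let ?d = "N * N + 2 * N + 24 - 4 * (t + t' - s - s')"
  have "0 \<le> (t + 2 * s) * (t + N)" using assms by (intro mult_nonneg_nonneg) auto
  have "t * ?d = t * (N * N) + 2 * N * t + 24 * t - 4 * (t * t) - 4 * (t * t') + 4 * (t * s) + 4 * (t * s')"
    by (simp add: algebra_simps)
  also have "\<dots> = (t - 4) * (N * N - 6 * t) + 2 * ((t + 2 * s) * (t + N))"
    unfolding assms(1) assms(2)[symmetric] by (simp add: algebra_simps)
  finally have d: "t * ?d \<ge> (t - 4) * (N * N - 6 * t)"
    using \<open>0 \<le> (t + 2 * s) * (t + N)\<close> by linarith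
  \<comment> \<open>With \<open>t \<le> N\<close> this gives 6t < 8N <= N^2; it is the place where
    \<open>8 \<le> N\<close>, that is \<open>3 \<le> r\<close>, enters.\<close>
  have "8 * N \<le> N * N" using assms(6) by (intro mult_right_mono) auto
  hence pos: "0 < N * N - 6 * t" using assms(5,6) by linarith
  hence "0 \<le> (t - 4) * (N * N - 6 * t)" using assms(4) by (intro mult_nonneg_nonneg) auto
  hence "0 \<le> t * ?d" using d by linarith
  hence "0 \<le> ?d" using assms(4) by (simp add: zero_le_mult_iff)
  thus "4 * (t + t' - s - s') \<le> N * N + 2 * N + 24" by linarith
  assume "t \<noteq> 4"
  hence "0 < (t - 4) * (N * N - 6 * t)" using assms(4) pos by (intro mult_pos_pos) auto
  hence "0 < t * ?d" using d by linarith
  hence "0 < ?d" using assms(4) by (simp add: zero_less_mult_iff)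
  thus "4 * (t + t' - s - s') < N * N + 2 * N + 24" by linarith
qed

lemma eight_le_power2:
  assumes "3 \<le> r"
  shows "8 \<le> (2 :: int) ^ r"
  using power_increasing[OF assms, of "2 :: int"] by simp

lemma power2_double: "(2 :: 'a :: semiring_1) ^ (2 * r) = 2 ^ r * 2 ^ r"
  by (simp add: mult_2 power_add)

lemma int_eq_power2_double: "m = 2 ^ (2 * r) \<Longrightarrow> int m = 2 ^ r * 2 ^ r"
  by (simp add: power2_double)

text \<open>The hypotheses relating \<open>U\<close> and \<open>W\<close> hold for \<open>W = orth r U\<close>; they are stated
  symmetrically so that the bound can be applied to the smaller of the two subspaces.\<close>
lemma (in hyperbolic_pair) orthogonal_pair_bound:
  assumes r: "3 \<le> r"
    and U: "f2_subspace r U" and W: "f2_subspace r W"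
    and card: "card U * card W = 2 ^ (2 * r)"
    and sign: "2 ^ r * sign_sum r U = int (card U) * sign_sum r W"
    and xyU: "x \<in> U" "y \<in> U" and le: "card U \<le> 2 ^ r"
  shows "8 * int (card (hyp_quadric_verts r \<inter> U)) + 8 * int (card (hyp_quadric_verts r \<inter> W))
      \<le> 2 ^ r * 2 ^ r + 2 * 2 ^ r + 24" (is "?l \<le> ?b")
    and "8 * int (card (hyp_quadric_verts r \<inter> U)) + 8 * int (card (hyp_quadric_verts r \<inter> W))
      = 2 ^ r * 2 ^ r + 2 * 2 ^ r + 24 \<Longrightarrow> U = hyp_line r x y"
proof -
  have line: "hyp_line r x y \<subseteq> U" using U xyU by (rule hyp_line_subset)
  have fin: "finite U" using U by (rule f2_subspace_finite)
  have l: "?l = 4 * (int (card U) + int (card W) - sign_sum r U - sign_sum r W)"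
    using two_card_quadric_Int[OF U] two_card_quadric_Int[OF W] by simp
  have 1: "int (card U) * int (card W) = 2 ^ r * 2 ^ r"
    using int_eq_power2_double[OF card] by simp
  have 4: "4 \<le> int (card U)"
    using card_mono[OF fin line] by (simp add: card_hyp_line)
  have 5: "int (card U) \<le> 2 ^ r"
    using le by (metis of_nat_le_iff of_nat_numeral of_nat_power)
  note arith = orthogonal_pair_bound_arith[OF 1 sign sign_sum_bound[OF U xyU] 4 5 eight_le_power2[OF r]]
  show "?l \<le> ?b" using arith(1) l by simp
  assume "?l = ?b"
  hence "int (card U) = 4" using arith(2) l by linarith
  hence "card (hyp_line r x y) = card U" by (simp add: card_hyp_line)
  thus "U = hyp_line r x y" using card_subset_eq[OF fin line] by simp
qed

text \<open>Replacing \<open>A\<close> and \<open>B\<close> by all vertices of two orthogonal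
  subspaces only enlarges them, so the subspace bound applies. In the case of equality nothing was
  added, and the smaller subspace is a hyperbolic line with 0.\<close>

lemma orthogonal_parts_bound:
  assumes r: "3 \<le> r"
    and A: "A \<subseteq> hyp_quadric_verts r" and B: "B \<subseteq> hyp_quadric_verts r"
    and AB: "\<And>a b. a \<in> A \<Longrightarrow> b \<in> B \<Longrightarrow> polar_form r a b = 0"
    and xy: "x \<in> A" "y \<in> A" "polar_form r x y = 1"
    and zw: "z \<in> B" "w \<in> B" "polar_form r z w = 1"
  shows "8 * int (card A) + 8 * int (card B) \<le> 2 ^ r * 2 ^ r + 2 * 2 ^ r + 24"
    and "8 * int (card A) + 8 * int (card B) = 2 ^ r * 2 ^ r + 2 * 2 ^ r + 24 \<Longrightarrow>
      \<exists>u v. hyperbolic_pair r u v \<and>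
        A \<union> B = {u, v, u + v} \<union> (hyp_quadric_verts r \<inter> orth r {u, v, u + v})"
proof -
  let ?V = "hyp_quadric_verts r"
  define U where "U = orth r B"
  define W where "W = orth r U"
  note fin = finite_hyp_quadric_verts[of r]
  have U: "f2_subspace r U" and W: "f2_subspace r W"
    unfolding U_def W_def by (rule f2_subspace_orth)+
  have AU: "A \<subseteq> ?V \<inter> U"
    using A AB by (auto simp: U_def orth_def hyp_quadric_verts_eq)
  have BW: "B \<subseteq> ?V \<inter> W"
    using B by (auto simp: U_def W_def orth_def hyp_quadric_verts_eq polar_form_commute)
  have cA: "int (card A) \<le> int (card (?V \<inter> U))" and cB: "int (card B) \<le> int (card (?V \<inter> W))"
    using AU BW fin by (auto intro: card_mono)
  have card: "card U * card W = 2 ^ (2 * r)"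
    unfolding W_def by (rule card_orth[OF U])
  hence card': "card W * card U = 2 ^ (2 * r)" by (simp add: mult.commute)
  have sign: "2 ^ r * sign_sum r U = int (card U) * sign_sum r W"
    unfolding W_def by (rule sign_sum_orth[OF U])
  have icard: "int (card W) * int (card U) = 2 ^ r * 2 ^ r"
    using int_eq_power2_double[OF card'] by simp
  \<comment> \<open>The relation \<open>sign\<close> with \<open>U\<close> and \<open>W\<close>
    exchanged: multiply it by \<open>card W\<close>, insert the product of the two sizes and cancel
    \<open>2 ^ r\<close>.\<close>
  have "2 ^ r * (2 ^ r * sign_sum r W) = int (card W) * (int (card U) * sign_sum r W)"
    using icard by (simp flip: mult.assoc)
  also have "\<dots> = 2 ^ r * (int (card W) * sign_sum r U)"
    by (simp flip: sign add: mult_ac)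
  finally have sign': "2 ^ r * sign_sum r W = int (card W) * sign_sum r U"
    by simp
  interpret xy: hyperbolic_pair r x y using xy A by unfold_locales auto
  interpret zw: hyperbolic_pair r z w using zw B by unfold_locales auto
  have mem: "x \<in> U" "y \<in> U" "z \<in> W" "w \<in> W" using AU BW xy zw by auto
  let ?b = "2 ^ r * 2 ^ r + 2 * 2 ^ r + 24 :: int"
  let ?c = "8 * int (card (?V \<inter> U)) + 8 * int (card (?V \<inter> W))"
  have eqA: "A = ?V \<inter> U" and eqB: "B = ?V \<inter> W"
    if "?c \<le> ?b" "8 * int (card A) + 8 * int (card B) = ?b"
  proof -
    have "int (card A) = int (card (?V \<inter> U))" using that cA cB by linarith
    thus "A = ?V \<inter> U" using AU fin by (intro card_subset_eq) auto
    have "int (card B) = int (card (?V \<inter> W))" using that cA cB by linarith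
    thus "B = ?V \<inter> W" using BW fin by (intro card_subset_eq) auto
  qed
  have le: "?c \<le> ?b" and
    ex: "8 * int (card A) + 8 * int (card B) = ?b \<Longrightarrow>
      \<exists>u v. hyperbolic_pair r u v \<and> A \<union> B = {u, v, u + v} \<union> (?V \<inter> orth r {u, v, u + v})"
  proof -
    \<comment> \<open>The sizes multiply to the square of \<open>2 ^ r\<close>, so they cannot both
      exceed it.\<close>
    consider "card U \<le> 2 ^ r" | "card W \<le> 2 ^ r"
    proof (cases "card U \<le> 2 ^ r")
      case False
      have "card W * card U = 2 ^ r * 2 ^ r" using card' by (simp add: power2_double)
      hence "\<not> 2 ^ r < card W"
        using False mult_strict_mono[of "2 ^ r" "card W" "2 ^ r" "card U"] by auto
      thus ?thesis using that(2) by simp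
    qed (use that in auto)
    hence "?c \<le> ?b \<and> (8 * int (card A) + 8 * int (card B) = ?b \<longrightarrow>
      (\<exists>u v. hyperbolic_pair r u v \<and> A \<union> B = {u, v, u + v} \<union> (?V \<inter> orth r {u, v, u + v})))"
    proof cases
      case 1
      note b = xy.orthogonal_pair_bound[OF r U W card sign mem(1,2) 1]
      have "A \<union> B = {x, y, x + y} \<union> (?V \<inter> orth r {x, y, x + y})"
        if e: "8 * int (card A) + 8 * int (card B) = ?b"
      proof -
        have "?c = ?b" using e b(1) cA cB by linarith
        hence UH: "U = hyp_line r x y" by (rule b(2))
        have "A = {x, y, x + y}" using eqA[OF b(1) e] UH xy.quadric_Int_hyp_line by simp
        moreover have "B = ?V \<inter> orth r {x, y, x + y}"
          using eqB[OF b(1) e] UH xy.orth_hyp_line by (simp add: W_def)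
        ultimately show ?thesis by simp
      qed
      thus ?thesis using b(1) xy.hyperbolic_pair_axioms by blast
    next
      case 2
      note b = zw.orthogonal_pair_bound[OF r W U card' sign' mem(3,4) 2, unfolded add.commute[of "8 * int (card (?V \<inter> W))"]]
      have "A \<union> B = {z, w, z + w} \<union> (?V \<inter> orth r {z, w, z + w})"
        if e: "8 * int (card A) + 8 * int (card B) = ?b"
      proof -
        have "?c = ?b" using e b(1) cA cB by linarith
        hence WH: "W = hyp_line r z w" by (rule b(2))
        have BH: "B = {z, w, z + w}" using eqB[OF b(1) e] WH zw.quadric_Int_hyp_line by simp
        \<comment> \<open>Here \<open>U\<close> is the orthogonal complement of \<open>B\<close> by
          definition, and \<open>B\<close> is now known to be the line.\<close>
        moreover have "A = ?V \<inter> orth r {z, w, z + w}"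
          using eqA[OF b(1) e] BH by (simp add: U_def)
        ultimately show ?thesis by blast
      qed
      thus ?thesis using b(1) zw.hyperbolic_pair_axioms by blast
    qed
    thus "?c \<le> ?b" "8 * int (card A) + 8 * int (card B) = ?b \<Longrightarrow>
      \<exists>u v. hyperbolic_pair r u v \<and> A \<union> B = {u, v, u + v} \<union> (?V \<inter> orth r {u, v, u + v})"
      by blast+
  qed
  show "8 * int (card A) + 8 * int (card B) \<le> ?b" using le cA cB by linarith
  show "8 * int (card A) + 8 * int (card B) = ?b \<Longrightarrow>
      \<exists>u v. hyperbolic_pair r u v \<and> A \<union> B = {u, v, u + v} \<union> (?V \<inter> orth r {u, v, u + v})"
    by (rule ex)
qed

lemma two_card_hyp_quadric_verts: "2 * int (card (hyp_quadric_verts r)) = 2 ^ r * 2 ^ r - 2 ^ r"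
proof -
  have "hyp_quadric_verts r \<inter> carrier_vec (2 * r) = hyp_quadric_verts r"
    by (auto simp: hyp_quadric_verts_eq)
  thus ?thesis
    using two_card_quadric_Int[OF f2_subspace_carrier[of r]]
    by (simp add: sign_sum_carrier card_carrier_bit_vec power2_double)
qed

section \<open>Neighborhoods of hyperbolic lines\<close>

context hyperbolic_pair
begin

abbreviation "perp_verts \<equiv> hyp_quadric_verts r \<inter> orth r {x, y, x + y}"

lemma neighborhood_hyp_line:
  "neighborhood (hyp_quadric_graph r) {x, y, x + y} =
    hyp_quadric_verts r - ({x, y, x + y} \<union> perp_verts)"
  unfolding neighborhood_def hyp_quadric_dominates
  using x y add_xy by (auto simp: orth_def hyp_quadric_verts_eq)

lemma disjoint_perp_verts: "{x, y, x + y} \<inter> perp_verts = {}"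
  by (auto simp: orth_def)

lemma card_orth_hyp_line: "4 * card (orth r {x, y, x + y}) = 2 ^ (2 * r)"
  using card_orth[OF hyp_line_subspace] by (simp add: card_hyp_line orth_hyp_line)

text \<open>The sign sum of the plane is 1 - 3 = -2, so that of its complement is -N/2 with N =
  \<open>2 ^ r\<close>. The first equation shows that \<open>perp_verts\<close> is more than half of
  the complement; the second gives its size.\<close>

lemma card_perp_verts:
  "4 * int (card perp_verts) = 2 * int (card (orth r {x, y, x + y})) + 2 ^ r"
  "8 * int (card perp_verts) = 2 ^ r * 2 ^ r + 2 * 2 ^ r"
proof -
  have "2 ^ r * (-2) = 4 * sign_sum r (orth r {x, y, x + y})"
    using sign_sum_orth[OF hyp_line_subspace]
    by (simp add: card_hyp_line sign_sum_hyp_line orth_hyp_line)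
  thus *: "4 * int (card perp_verts) = 2 * int (card (orth r {x, y, x + y})) + 2 ^ r"
    using two_card_quadric_Int[OF f2_subspace_orth[of r "{x, y, x + y}"]] by linarith
  have "4 * int (card (orth r {x, y, x + y})) = 2 ^ r * 2 ^ r"
    using int_eq_power2_double[OF card_orth_hyp_line] by simp
  thus "8 * int (card perp_verts) = 2 ^ r * 2 ^ r + 2 * 2 ^ r"
    using * by linarith
qed

text \<open>If all of \<open>perp_verts\<close> were orthogonal to \<open>b\<close>, then a translation by an element not
  orthogonal to \<open>b\<close> would show that \<open>perp_verts\<close> is at most half of the subspace.\<close>
lemma perp_verts_not_isolated:
  assumes b: "b \<in> perp_verts"
  shows "\<exists>c\<in>perp_verts. polar_form r b c = 1"
proof (rule ccontr)
  let ?W = "orth r {x, y, x + y}"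
  assume "\<not> ?thesis"
  hence orthb: "polar_form r b c = 0" if "c \<in> perp_verts" for c
    using that by (metis bit_not_one_iff)
  have W: "f2_subspace r ?W" by (rule f2_subspace_orth)
  have finW: "finite ?W" using W by (rule f2_subspace_finite)
  \<comment> \<open>Counting shows that the double complement of the line is again the line. Since
    \<open>b\<close> lies outside it, some \<open>a\<close> in \<open>?W\<close> is not orthogonal
    to \<open>b\<close>.\<close>
  have "card ?W * card (orth r ?W) = card ?W * 4"
    using card_orth[OF W] card_orth_hyp_line by simp
  moreover have "card ?W \<noteq> 0" using card_orth_hyp_line by (cases "card ?W = 0") auto
  ultimately have "card (orth r ?W) = 4" by simp
  moreover have "hyp_line r x y \<subseteq> orth r ?W"
    using polar_form_commute[of r] by (auto simp: hyp_line_def orth_def)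
  moreover have "finite (orth r ?W)" using f2_subspace_finite[OF f2_subspace_orth] .
  ultimately have WW: "orth r ?W = hyp_line r x y"
    using card_subset_eq card_hyp_line by metis
  have "b \<notin> orth r ?W"
    using b quadric_Int_hyp_line disjoint_perp_verts unfolding WW by blast
  moreover have bc: "b \<in> carrier_vec (2 * r)" using b by (auto simp: orth_def)
  ultimately obtain a where a: "a \<in> ?W" "polar_form r b a = 1"
    unfolding orth_def[of r ?W] mem_Collect_eq by (metis bit_not_zero_iff)
  have ac: "a \<in> carrier_vec (2 * r)" and cc: "perp_verts \<subseteq> carrier_vec (2 * r)"
    using a by (auto simp: orth_def)
  let ?B' = "(\<lambda>c. c + a) ` perp_verts"
  have "inj_on (\<lambda>c. c + a) perp_verts"
    by (rule inj_on_inverseI[of _ "\<lambda>c. c + a"]) (use ac cc bit_vec_add_cancel in blast)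
  hence card: "card ?B' = card perp_verts" by (rule card_image)
  have shifted: "polar_form r b (c + a) = 1" if "c \<in> perp_verts" for c
    using that cc ac a(2) orthb[OF that] by (subst polar_form_add_right) auto
  have disj: "perp_verts \<inter> ?B' = {}"
  proof (rule equals0I)
    fix d assume "d \<in> perp_verts \<inter> ?B'"
    then obtain c where "d \<in> perp_verts" "c \<in> perp_verts" "d = c + a" by blast
    thus False using shifted[of c] orthb[of d] by simp
  qed
  have "?B' \<subseteq> ?W" using W a(1) unfolding f2_subspace_def by blast
  hence "card (perp_verts \<union> ?B') \<le> card ?W" using finW by (intro card_mono) auto
  moreover have fin: "finite perp_verts" using finite_hyp_quadric_verts by blast
  moreover have "card (perp_verts \<union> ?B') = card perp_verts + card ?B'"
    by (rule card_Un_disjoint[OF fin finite_imageI[OF fin] disj])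
  ultimately have "4 * int (card perp_verts) \<le> 2 * int (card ?W)" using card by simp
  moreover have "0 < (2 :: int) ^ r" by simp
  ultimately show False using card_perp_verts(1) by linarith
qed

text \<open>Deleting the neighborhood leaves the line and \<open>perp_verts\<close>, with no edges
  between them. The line is a triangle, and \<open>perp_verts\<close> has no isolated
  vertex.\<close>

lemma disconnecting_set2_neighborhood:
  "disconnecting_set2 (hyp_quadric_graph r) (neighborhood (hyp_quadric_graph r) {x, y, x + y})"
proof -
  interpret graph "hyp_quadric_graph r" by (rule graph_hyp_quadric_graph)
  let ?V = "hyp_quadric_verts r"
  let ?S = "neighborhood (hyp_quadric_graph r) {x, y, x + y}"
  have rest: "?V - ?S = {x, y, x + y} \<union> perp_verts"
    unfolding neighborhood_hyp_line using x y add_xy by blast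
  have "0 < 8 * int (card perp_verts)"
    unfolding card_perp_verts(2) by (intro add_pos_pos mult_pos_pos) auto
  hence ne: "perp_verts \<noteq> {}" by (metis card.empty mult_zero_right of_nat_0 order_less_irrefl)
  have "\<not> a \<rightarrow>\<^bsub>hyp_quadric_graph r\<^esub> b" if "a \<in> {x, y, x + y}" "b \<in> perp_verts" for a b
    using that polar_form_commute[of r a b] unfolding hyp_quadric_dominates by (auto simp: orth_def)
  moreover have "\<exists>w\<in>?V - ?S. v \<rightarrow>\<^bsub>hyp_quadric_graph r\<^esub> w" if "v \<in> ?V - ?S" for v
  proof (cases "v \<in> perp_verts")
    case True
    then obtain w where "w \<in> perp_verts" "polar_form r v w = 1"
      using perp_verts_not_isolated by blast
    thus ?thesis using True unfolding rest hyp_quadric_dominates by blast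
  next
    case False
    hence "v \<in> {x, y, x + y}" using that rest by blast
    then obtain w where "w \<in> {x, y}" "polar_form r v w = 1"
      using polar_form_xy by blast
    moreover have "v \<in> ?V" using that by blast
    ultimately show ?thesis using x y unfolding rest hyp_quadric_dominates by blast
  qed
  ultimately show ?thesis
    unfolding disconnecting_set2_iff verts_hyp_quadric_graph rest
    using disjoint_perp_verts ne
    by (intro conjI exI[of _ "{x, y, x + y}"] exI[of _ perp_verts])
      (auto simp: neighborhood_hyp_line)
qed

text \<open>The count is \<open>card ?V - 3 - card perp_verts\<close>. The factor 8 clears all
  denominators, so it becomes a polynomial in \<open>2 ^ r\<close> without exponents such as
  \<open>2 * r - 3\<close>.\<close>

lemma card_neighborhood_hyp_line:
  "8 * int (card (neighborhood (hyp_quadric_graph r) {x, y, x + y})) =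
    3 * (2 ^ r * 2 ^ r) - 6 * 2 ^ r - 24"
proof -
  let ?V = "hyp_quadric_verts r"
  have fin: "finite perp_verts" using finite_hyp_quadric_verts by blast
  have sub: "{x, y, x + y} \<union> perp_verts \<subseteq> ?V" using x y add_xy by blast
  have "card {x, y, x + y} = 3" using distinct_xy by simp
  hence "card ({x, y, x + y} \<union> perp_verts) = 3 + card perp_verts"
    using card_Un_disjoint[OF _ fin disjoint_perp_verts] by simp
  hence "int (card (neighborhood (hyp_quadric_graph r) {x, y, x + y})) =
      int (card ?V) - (3 + int (card perp_verts))"
    unfolding neighborhood_hyp_line
    using card_Diff_subset[OF finite_subset[OF sub finite_hyp_quadric_verts] sub]
      card_mono[OF finite_hyp_quadric_verts sub] by simp
  thus ?thesis using two_card_hyp_quadric_verts[of r] card_perp_verts(2) by simp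
qed

end

section \<open>The lower bound and its equality case\<close>

lemma disconnecting_set2_card_bound:
  assumes r: "3 \<le> r" and S: "disconnecting_set2 (hyp_quadric_graph r) S"
  shows "3 * (2 ^ r * 2 ^ r) - 6 * 2 ^ r - 24 \<le> 8 * int (card S)"
    and "8 * int (card S) = 3 * (2 ^ r * 2 ^ r) - 6 * 2 ^ r - 24 \<Longrightarrow>
      \<exists>x y. hyperbolic_pair r x y \<and> S = neighborhood (hyp_quadric_graph r) {x, y, x + y}"
proof -
  interpret graph "hyp_quadric_graph r" by (rule graph_hyp_quadric_graph)
  let ?V = "hyp_quadric_verts r"
  have sub: "S \<subseteq> ?V" and nb: "\<forall>v\<in>?V - S. \<exists>w\<in>?V - S. v \<rightarrow>\<^bsub>hyp_quadric_graph r\<^esub> w"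
    using S unfolding disconnecting_set2_iff verts_hyp_quadric_graph by blast+
  obtain A B where AB: "A \<union> B = ?V - S" "A \<inter> B = {}" "A \<noteq> {}" "B \<noteq> {}"
      "\<forall>a\<in>A. \<forall>b\<in>B. \<not> a \<rightarrow>\<^bsub>hyp_quadric_graph r\<^esub> b"
    using S unfolding disconnecting_set2_iff verts_hyp_quadric_graph by blast
  have ABV: "A \<subseteq> ?V" "B \<subseteq> ?V" using AB(1) by auto
  have perp: "polar_form r a b = 0" if "a \<in> A" "b \<in> B" for a b
  proof -
    have "polar_form r a b \<noteq> 1" using AB(5) that ABV unfolding hyp_quadric_dominates by blast
    thus ?thesis by simp
  qed
  obtain x where x: "x \<in> A" using AB(3) by blast
  obtain y where y: "y \<in> A \<union> B" "polar_form r x y = 1"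
    using nb x AB(1) unfolding hyp_quadric_dominates by blast
  \<comment> \<open>A neighbor of \<open>x\<close> that survives the deletion cannot lie in the
    other part, so \<open>A\<close> contains an edge; the same holds for \<open>B\<close>.\<close>
  have yA: "y \<in> A" using y perp[OF x, of y] by auto
  obtain z where z: "z \<in> B" using AB(4) by blast
  obtain w where w: "w \<in> A \<union> B" "polar_form r z w = 1"
    using nb z AB(1) unfolding hyp_quadric_dominates by blast
  have wB: "w \<in> B" using w perp[OF _ z, of w] polar_form_commute[of r z w] by auto
  note bound = orthogonal_parts_bound[OF r ABV perp x yA y(2) z wB w(2)]
  have fin: "finite A" "finite B"
    using ABV finite_hyp_quadric_verts finite_subset by blast+
  have SD: "S = ?V - (A \<union> B)" using AB(1) sub by blast
  have "card (A \<union> B) = card A + card B"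
    using fin AB(2) by (rule card_Un_disjoint)
  moreover have "A \<union> B \<subseteq> ?V" using ABV by blast
  ultimately have cS: "int (card S) = int (card ?V) - (int (card A) + int (card B))"
    unfolding SD using card_Diff_subset[of "A \<union> B" ?V] card_mono[OF finite_hyp_quadric_verts[of r], of "A \<union> B"] fin
    by simp
  show "3 * (2 ^ r * 2 ^ r) - 6 * 2 ^ r - 24 \<le> 8 * int (card S)"
    using bound(1) cS two_card_hyp_quadric_verts[of r] by linarith
  assume "8 * int (card S) = 3 * (2 ^ r * 2 ^ r) - 6 * 2 ^ r - 24"
  hence "8 * int (card A) + 8 * int (card B) = 2 ^ r * 2 ^ r + 2 * 2 ^ r + 24"
    using cS two_card_hyp_quadric_verts[of r] by linarith
  then obtain u v where uv: "hyperbolic_pair r u v"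
      "A \<union> B = {u, v, u + v} \<union> (?V \<inter> orth r {u, v, u + v})"
    using bound(2) by blast
  show "\<exists>x y. hyperbolic_pair r x y \<and> S = neighborhood (hyp_quadric_graph r) {x, y, x + y}"
    using uv SD hyperbolic_pair.neighborhood_hyp_line[OF uv(1)] by auto
qed

lemma hyperbolic_pair_exists:
  assumes "2 \<le> r"
  shows "\<exists>x y. hyperbolic_pair r x y"
proof -
  obtain n where n: "r = Suc (Suc n)" using assms by (metis Suc_le_D numeral_2_eq_2 Suc_le_mono)
  \<comment> \<open>An edge uses two blocks, since a single block has (1,1) as its only vertex. The
    vector \<open>?y\<close> takes its quadratic value from the second block and pairs with
    \<open>?x\<close> in the first.\<close>
  let ?x = "vec (2 * r) (\<lambda>i. of_bool (i \<in> {0, 1})) :: bit vec"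
  let ?y = "vec (2 * r) (\<lambda>i. of_bool (i \<in> {0, 2, 3})) :: bit vec"
  have "hyperbolic_pair r ?x ?y"
    by unfold_locales
      (simp_all add: hyp_quadric_verts_eq quad_form_def polar_form_def n sum.lessThan_Suc_shift del: sum.lessThan_Suc)
  thus ?thesis by blast
qed

lemma hyperbolic_pair_iff_dominates:
  "hyperbolic_pair r x y \<longleftrightarrow> x \<rightarrow>\<^bsub>hyp_quadric_graph r\<^esub> y"
  unfolding hyperbolic_pair_def hyp_quadric_dominates ..

theorem proposition6p1:
  fixes r :: nat and k lam :: int
  assumes "r \<ge> 3"
    and "k = 2 ^ (2 * r - 2) - 2 ^ (r - 1)"
    and "lam = 2 ^ (2 * r - 3) - 2 ^ (r - 2)"
  shows "int (kappa2 (hyp_quadric_graph r)) = 3 * (2 ^ (2 * r - 3) - 2 ^ (r - 2)) - 3 \<and>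
    int (kappa2 (hyp_quadric_graph r)) = 2 * k - lam - 3 \<and>
    (\<forall>S. disconnecting_set2 (hyp_quadric_graph r) S \<and> card S = kappa2 (hyp_quadric_graph r)
       \<longleftrightarrow> (\<exists>x y. x \<rightarrow>\<^bsub>hyp_quadric_graph r\<^esub> y \<and>
              S = neighborhood (hyp_quadric_graph r) {x, y, x + y}))"
proof -
  let ?G = "hyp_quadric_graph r"
  let ?m = "3 * (2 ^ r * 2 ^ r) - 6 * 2 ^ r - 24 :: int"
  obtain x y where xy: "hyperbolic_pair r x y" using hyperbolic_pair_exists[of r] assms(1) by auto
  let ?N = "neighborhood ?G {x, y, x + y}"
  have N: "disconnecting_set2 ?G ?N" "8 * int (card ?N) = ?m"
    using hyperbolic_pair.disconnecting_set2_neighborhood[OF xy]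
      hyperbolic_pair.card_neighborhood_hyp_line[OF xy] by auto
  have "kappa2 ?G = card ?N"
    unfolding kappa2_def
  proof (rule cInf_eq_minimum)
    fix n assume "n \<in> {card S |S. disconnecting_set2 ?G S}"
    then obtain S where S: "disconnecting_set2 ?G S" "n = card S" by blast
    have "8 * int (card ?N) \<le> 8 * int n"
      using disconnecting_set2_card_bound(1)[OF assms(1) S(1)] N(2) S(2) by linarith
    thus "card ?N \<le> n" by simp
  qed (use N(1) in blast)
  hence kappa: "8 * int (kappa2 ?G) = ?m" using N(2) by simp
  \<comment> \<open>Substituting r = 3 + n removes the truncated subtraction from all
    exponents.\<close>
  have "r = 3 + (r - 3)" using assms(1) by simp
  then obtain n where n: "r = 3 + n" by blast
  have e: "2 * r - 3 = 3 + n + n" "2 * r - 2 = 4 + n + n" "r - 2 = Suc n" "r - 1 = Suc (Suc n)"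
    by (simp_all add: n)
  have lam: "8 * lam = 2 ^ r * 2 ^ r - 2 * 2 ^ r" and k: "4 * k = 2 ^ r * 2 ^ r - 2 * 2 ^ r"
    unfolding assms(2,3) e n by (simp_all add: power_add power2_double)
  have k1: "int (kappa2 ?G) = 3 * lam - 3" using kappa lam by linarith
  have k2: "int (kappa2 ?G) = 2 * k - lam - 3" using kappa lam k by linarith
  have "disconnecting_set2 ?G S \<and> card S = kappa2 ?G \<longleftrightarrow>
      (\<exists>x y. x \<rightarrow>\<^bsub>?G\<^esub> y \<and> S = neighborhood ?G {x, y, x + y})" for S
  proof
    assume "disconnecting_set2 ?G S \<and> card S = kappa2 ?G"
    thus "\<exists>x y. x \<rightarrow>\<^bsub>?G\<^esub> y \<and> S = neighborhood ?G {x, y, x + y}"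
      using disconnecting_set2_card_bound(2)[OF assms(1), of S] kappa
      by (auto simp: hyperbolic_pair_iff_dominates)
  next
    assume "\<exists>x y. x \<rightarrow>\<^bsub>?G\<^esub> y \<and> S = neighborhood ?G {x, y, x + y}"
    then obtain u v where uv: "hyperbolic_pair r u v" "S = neighborhood ?G {u, v, u + v}"
      by (auto simp: hyperbolic_pair_iff_dominates)
    \<comment> \<open>The size of the neighborhood does not depend on the chosen edge, so every such
      set attains the minimum.\<close>
    have "8 * int (card S) = 8 * int (kappa2 ?G)"
      using hyperbolic_pair.card_neighborhood_hyp_line[OF uv(1)] kappa uv(2) by simp
    thus "disconnecting_set2 ?G S \<and> card S = kappa2 ?G"
      using hyperbolic_pair.disconnecting_set2_neighborhood[OF uv(1)] uv(2) by simp
  qed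
  thus ?thesis using k1 k2 assms(3) by blast
qed

end
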